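(* There is a one-to-one correspondence between skeletal $\mathrm{Dend}_\infty$-algebras and tuples $(A,M,\theta_1,\theta_2,\sigma)$ consisting of a dendriform algebra $A$, a representation $(M,\theta_1,\theta_2)$ of $A$ and a $3$-cocycle $\sigma:\mathbb{K}[C_3]\otimes A^{\otimes3}\to M$ of the dendriform algebra $A$ with coefficients in $M$.
   Context: $\mathbb{K}$ is a field of characteristic $0$. $C_n=\{[1],\ldots,[n]\}$ is a set of $n$ symbols, $\mathbb{K}[C_n]$ the vector space with basis $C_n$. For $1\le i\le m$, $n\ge 1$: $R_0^{m,n,i}:C_{m+n-1}\to C_m$ sends $[r]$ to $[r]$ if $r\le i-1$, to $[i]$ if $i\le r\le i+n-1$, to $[r-n+1]$ if $r\ge i+n$; $R^{m,n,i}:C_{m+n-1}\to\mathbb{K}[C_n]$ sends $[r]$ to $[r-i+1]$ if $i\le r\le i+n-1$ and to $[1]+\cdots+[n]$ otherwise. For maps $f$ with $m$ inputs labelled by $C_m$ and $g$ with $n$ inputs labelled by $C_n$ (extended linearly in the label), $(f\circ_i g)([r];x_1,\ldots,x_{m+n-1})=f(R_0^{m,n,i}[r];x_1,\ldots,x_{i-1},g(R^{m,n,i}[r];x_i,\ldots,x_{i+n-1}),x_{i+n},\ldots,x_{m+n-1})$ whenever the inputs make sense. A $2$-term $\mathrm{Dend}_\infty$-algebra $(A_1\xrightarrow{d}A_0,\mu_2,\mu_3)$ consists of a chain complex $A_1\xrightarrow{d}A_0$, bilinear maps $\mu_2:\mathbb{K}[C_2]\otimes(A_i\otimes A_j)\to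 A_{i+j}$ (with $A_2=0$) and a trilinear map $\mu_3:\mathbb{K}[C_3]\otimes(A_0\otimes A_0\otimes A_0)\to A_1$ such that for all $a,b,c,e\in A_0$, $m,n\in A_1$, $[r]\in C_2$, $[s]\in C_3$, $[t]\in C_4$: (i) $\mu_2([r];m,n)=0$; (ii) $d\mu_2([r];a,m)=\mu_2([r];a,dm)$; (iii) $d\mu_2([r];m,a)=\mu_2([r];dm,a)$; (iv) $\mu_2([r];dm,n)=\mu_2([r];m,dn)$; (v) $(\mu_2\circ_1\mu_2-\mu_2\circ_2\mu_2)([s];a,b,c)=d\mu_3([s];a,b,c)$; (vi1) $(\mu_2\circ_1\mu_2-\mu_2\circ_2\mu_2)([s];a,b,m)=\mu_3([s];a,b,dm)$; (vi2) $(\mu_2\circ_1\mu_2-\mu_2\circ_2\mu_2)([s];a,m,c)=\mu_3([s];a,dm,c)$; (vi3) $(\mu_2\circ_1\mu_2-\mu_2\circ_2\mu_2)([s];m,b,c)=\mu_3([s];dm,b,c)$; (vii) $(\mu_3\circ_1\mu_2-\mu_3\circ_2\mu_2+\mu_3\circ_3\mu_2)([t];a,b,c,e)=(\mu_2\circ_1\mu_3+\mu_2\circ_2\mu_3)([t];a,b,c,e)$. A $2$-term $\mathrm{Dend}_\infty$-algebra is called skeletal if $d=0$; a skeletal $\mathrm{Dend}_\infty$-algebra always means a skeletal $2$-term one. Dendriform algebra: a vector space $A$ with bilinear $\prec,\succ$ satisfying (D1) $(a\prec b)\prec c=a\prec(b\prec c+b\succ c)$, (D2) $(a\succ b)\prec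 c=a\succ(b\prec c)$, (D3) $(a\prec b+a\succ b)\succ c=a\succ(b\succ c)$; encoded by $\pi_A([1];a,b)=a\prec b$, $\pi_A([2];a,b)=a\succ b$. A representation of $A$ is a vector space $M$ with bilinear maps $\prec,\succ:A\otimes M\to M$ and $\prec,\succ:M\otimes A\to M$ such that (D1)-(D3) hold whenever exactly one of $a,b,c$ is in $M$ and the other two are in $A$; encoded by $\theta_1([1];a,m)=a\prec m$, $\theta_1([2];a,m)=a\succ m$, $\theta_2([1];m,a)=m\prec a$, $\theta_2([2];m,a)=m\succ a$. Cochains: $C^n_{\mathrm{dend}}(A,M)=\mathrm{Hom}_{\mathbb{K}}(\mathbb{K}[C_n]\otimes A^{\otimes n},M)$, with $$(\delta_{\mathrm{dend}}f)([r];a_1,\ldots,a_{n+1})=\theta_1\big(R_0^{2,n,2}[r];a_1,f(R^{2,n,2}[r];a_2,\ldots,a_{n+1})\big)$$ $$+\sum_{i=1}^n(-1)^i f\big(R_0^{n,2,i}[r];a_1,\ldots,a_{i-1},\pi_A(R^{n,2,i}[r];a_i,a_{i+1}),a_{i+2},\ldots,a_{n+1}\big)$$ $$+(-1)^{n+1}\theta_2\big(R_0^{2,n,1}[r];f(R^{2,n,1}[r];a_1,\ldots,a_n),a_{n+1}\big);$$ an $n$-cocycle is $f\in C^n_{\mathrm{dend}}(A,M)$ with $\delta_{\mathrm{dend}}f=0$. *)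

theory Defs
  imports Complex_Main "HOL-Library.Poly_Mapping" "HOL-Library.Product_Plus"
begin

text \<open>
  Vector spaces are types of class \<open>ab_group_add\<close> together with an explicit scalar multiplication
  satisfying the locale predicate \<open>vector_space\<close>. The symbol \<open>[r]\<close> of \<open>C_n\<close> is the natural number
  \<open>r \<in> {1..n}\<close>, and an element of \<open>K[C_n]\<close> is a \<open>nat \<Rightarrow>\<^sub>0 'k\<close> supported in \<open>{1..n}\<close>.
  An element of \<open>Hom(K[C_n] \<otimes> V \<otimes> \<dots> \<otimes> V, W)\<close> is a function \<open>f\<close> taking a label \<open>r\<close> and
  the list of its \<open>n\<close> inputs, multilinear in these; it is extended linearly in the label by
  \<open>lin_ext\<close>. So that each map is represented by exactly one HOL function, \<open>f\<close> is \<open>0\<close> on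
  arguments that are not of this form.
\<close>

definition R0 :: "nat \<Rightarrow> nat \<Rightarrow> nat \<Rightarrow> nat \<Rightarrow> nat" where
  "R0 m n i r = (if r < i then r else if r < i + n then i else r - n + 1)"

definition R :: "nat \<Rightarrow> nat \<Rightarrow> nat \<Rightarrow> nat \<Rightarrow> (nat \<Rightarrow>\<^sub>0 'k::field_char_0)" where
  "R m n i r = (if i \<le> r \<and> r < i + n then Poly_Mapping.single (r - i + 1) 1
                else (\<Sum>q = 1..n. Poly_Mapping.single q 1))"

definition lin_ext ::
  "('k::field_char_0 \<Rightarrow> 'w \<Rightarrow> 'w::ab_group_add) \<Rightarrow> nat \<Rightarrow> (nat \<Rightarrow> 'v list \<Rightarrow> 'w) \<Rightarrow>
   (nat \<Rightarrow>\<^sub>0 'k) \<Rightarrow> 'v list \<Rightarrow> 'w" where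
  "lin_ext s n g u xs = (\<Sum>q = 1..n. s (Poly_Mapping.lookup u q) (g q xs))"

text \<open>\<open>pcomp s m n i f g\<close> is \<open>f \<circ>\<^sub>i g\<close> for \<open>f\<close> with \<open>m\<close> and \<open>g\<close> with \<open>n\<close> inputs; \<open>s\<close> is the scalar
  multiplication of the space in which \<open>g\<close> takes its values.\<close>

definition pcomp ::
  "('k::field_char_0 \<Rightarrow> 'v \<Rightarrow> 'v::ab_group_add) \<Rightarrow> nat \<Rightarrow> nat \<Rightarrow> nat \<Rightarrow>
   (nat \<Rightarrow> 'v list \<Rightarrow> 'w) \<Rightarrow> (nat \<Rightarrow> 'v list \<Rightarrow> 'v) \<Rightarrow> nat \<Rightarrow> 'v list \<Rightarrow> 'w" where
  "pcomp s m n i f g r xs =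
     f (R0 m n i r)
       (take (i - 1) xs
        @ [lin_ext s n g (R m n i r) (take n (drop (i - 1) xs))]
        @ drop (i - 1 + n) xs)"

definition multilinear ::
  "('k::field_char_0 \<Rightarrow> 'v \<Rightarrow> 'v::ab_group_add) \<Rightarrow> ('k \<Rightarrow> 'w \<Rightarrow> 'w::ab_group_add) \<Rightarrow> nat \<Rightarrow>
   ('v list \<Rightarrow> 'w) \<Rightarrow> bool" where
  "multilinear s t n f \<longleftrightarrow>
     (\<forall>xs i. length xs = n \<longrightarrow> i < n \<longrightarrow> Vector_Spaces.linear s t (\<lambda>x. f (xs[i := x])))"

definition Hom_lab ::
  "('k::field_char_0 \<Rightarrow> 'v \<Rightarrow> 'v::ab_group_add) \<Rightarrow> ('k \<Rightarrow> 'w \<Rightarrow> 'w::ab_group_add) \<Rightarrow> nat \<Rightarrow>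
   (nat \<Rightarrow> 'v list \<Rightarrow> 'w) set" where
  "Hom_lab s t n =
     {f. (\<forall>r \<in> {1..n}. multilinear s t n (f r)) \<and>
         (\<forall>r xs. r \<notin> {1..n} \<or> length xs \<noteq> n \<longrightarrow> f r xs = 0)}"

definition bilin ::
  "('k::field_char_0 \<Rightarrow> 'u \<Rightarrow> 'u::ab_group_add) \<Rightarrow> ('k \<Rightarrow> 'v \<Rightarrow> 'v::ab_group_add) \<Rightarrow>
   ('k \<Rightarrow> 'w \<Rightarrow> 'w::ab_group_add) \<Rightarrow> ('u \<Rightarrow> 'v \<Rightarrow> 'w) \<Rightarrow> bool" where
  "bilin s1 s2 t f \<longleftrightarrow>
     (\<forall>x. Vector_Spaces.linear s2 t (f x)) \<and> (\<forall>y. Vector_Spaces.linear s1 t (\<lambda>x. f x y))"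

text \<open>
  The graded space \<open>A\<^sub>0 \<oplus> A\<^sub>1\<close> is the product type \<open>'a \<times> 'm\<close>. The families of maps \<open>\<mu>\<^sub>2\<close> and \<open>\<mu>\<^sub>3\<close>
  are multilinear maps on this total space, homogeneous of degree \<open>0\<close> and \<open>1\<close>. Since \<open>A\<^sub>k = 0\<close> for
  \<open>k \<ge> 2\<close>, homogeneity makes \<open>\<mu>\<^sub>2\<close> vanish on \<open>A\<^sub>1 \<otimes> A\<^sub>1\<close>, and makes \<open>\<mu>\<^sub>3\<close> vanish as soon as one
  input lies in \<open>A\<^sub>1\<close>, so that \<open>\<mu>\<^sub>3\<close> amounts to a trilinear map from \<open>A\<^sub>0\<close> to \<open>A\<^sub>1\<close>.
\<close>

record ('k, 'a, 'm) dend_inf =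
  scale0 :: "'k \<Rightarrow> 'a \<Rightarrow> 'a"
  scale1 :: "'k \<Rightarrow> 'm \<Rightarrow> 'm"
  diff :: "'m \<Rightarrow> 'a"
  mu2 :: "nat \<Rightarrow> ('a \<times> 'm) list \<Rightarrow> 'a \<times> 'm"
  mu3 :: "nat \<Rightarrow> ('a \<times> 'm) list \<Rightarrow> 'a \<times> 'm"

definition graded_part :: "nat \<Rightarrow> ('a::zero \<times> 'm::zero) set" where
  "graded_part k = {(a, x). (k \<noteq> 0 \<longrightarrow> a = 0) \<and> (k \<noteq> 1 \<longrightarrow> x = 0)}"

definition homogeneous ::
  "nat \<Rightarrow> (nat \<Rightarrow> ('a::zero \<times> 'm::zero) list \<Rightarrow> 'a \<times> 'm) \<Rightarrow> bool" where
  "homogeneous p f \<longleftrightarrow>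
     (\<forall>r ks xs. list_all2 (\<lambda>k x. x \<in> graded_part k) ks xs \<longrightarrow>
        f r xs \<in> graded_part (sum_list ks + p))"

definition scale_tot ::
  "('k, 'a, 'm) dend_inf \<Rightarrow> 'k \<Rightarrow> 'a \<times> 'm \<Rightarrow> 'a \<times> 'm" where
  "scale_tot X c v = (scale0 X c (fst v), scale1 X c (snd v))"

definition diff_tot :: "('k, 'a, 'm::zero) dend_inf \<Rightarrow> 'a \<times> 'm \<Rightarrow> 'a \<times> 'm" where
  "diff_tot X v = (diff X (snd v), 0)"

definition two_term_dend_inf ::
  "('k::field_char_0, 'a::ab_group_add, 'm::ab_group_add) dend_inf \<Rightarrow> bool" where
  "two_term_dend_inf X \<longleftrightarrow>
    (let s = scale_tot X; d = diff_tot X; \<mu>2 = mu2 X; \<mu>3 = mu3 X;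
         A0 = (graded_part 0 :: ('a \<times> 'm) set); A1 = (graded_part 1 :: ('a \<times> 'm) set);
         assoc = (\<lambda>r xs. pcomp s 2 2 1 \<mu>2 \<mu>2 r xs - pcomp s 2 2 2 \<mu>2 \<mu>2 r xs) in
     vector_space (scale0 X) \<and> vector_space (scale1 X) \<and>
     Vector_Spaces.linear (scale1 X) (scale0 X) (diff X) \<and>
     \<mu>2 \<in> Hom_lab s s 2 \<and> homogeneous 0 \<mu>2 \<and>
     \<mu>3 \<in> Hom_lab s s 3 \<and> homogeneous 1 \<mu>3 \<and>
     (\<forall>r\<in>{1..2}. \<forall>m\<in>A1. \<forall>n\<in>A1. \<mu>2 r [m, n] = 0) \<and>
     (\<forall>r\<in>{1..2}. \<forall>a\<in>A0. \<forall>m\<in>A1. d (\<mu>2 r [a, m]) = \<mu>2 r [a, d m]) \<and>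
     (\<forall>r\<in>{1..2}. \<forall>a\<in>A0. \<forall>m\<in>A1. d (\<mu>2 r [m, a]) = \<mu>2 r [d m, a]) \<and>
     (\<forall>r\<in>{1..2}. \<forall>m\<in>A1. \<forall>n\<in>A1. \<mu>2 r [d m, n] = \<mu>2 r [m, d n]) \<and>
     (\<forall>r\<in>{1..3}. \<forall>a\<in>A0. \<forall>b\<in>A0. \<forall>c\<in>A0. assoc r [a, b, c] = d (\<mu>3 r [a, b, c])) \<and>
     (\<forall>r\<in>{1..3}. \<forall>a\<in>A0. \<forall>b\<in>A0. \<forall>m\<in>A1. assoc r [a, b, m] = \<mu>3 r [a, b, d m]) \<and>
     (\<forall>r\<in>{1..3}. \<forall>a\<in>A0. \<forall>m\<in>A1. \<forall>c\<in>A0. assoc r [a, m, c] = \<mu>3 r [a, d m, c]) \<and>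
     (\<forall>r\<in>{1..3}. \<forall>m\<in>A1. \<forall>b\<in>A0. \<forall>c\<in>A0. assoc r [m, b, c] = \<mu>3 r [d m, b, c]) \<and>
     (\<forall>r\<in>{1..4}. \<forall>a\<in>A0. \<forall>b\<in>A0. \<forall>c\<in>A0. \<forall>e\<in>A0.
        pcomp s 3 2 1 \<mu>3 \<mu>2 r [a, b, c, e] - pcomp s 3 2 2 \<mu>3 \<mu>2 r [a, b, c, e]
          + pcomp s 3 2 3 \<mu>3 \<mu>2 r [a, b, c, e]
        = pcomp s 2 3 1 \<mu>2 \<mu>3 r [a, b, c, e] + pcomp s 2 3 2 \<mu>2 \<mu>3 r [a, b, c, e]))"

definition skeletal :: "('k, 'a::zero, 'm) dend_inf \<Rightarrow> bool" where
  "skeletal X \<longleftrightarrow> diff X = (\<lambda>_. 0)"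

record ('k, 'a) dend_alg =
  dscale :: "'k \<Rightarrow> 'a \<Rightarrow> 'a"
  dprec :: "'a \<Rightarrow> 'a \<Rightarrow> 'a"
  dsucc :: "'a \<Rightarrow> 'a \<Rightarrow> 'a"

definition dendriform :: "('k::field_char_0, 'a::ab_group_add) dend_alg \<Rightarrow> bool" where
  "dendriform A \<longleftrightarrow>
    (let p = dprec A; s = dsucc A in
     vector_space (dscale A) \<and>
     bilin (dscale A) (dscale A) (dscale A) p \<and> bilin (dscale A) (dscale A) (dscale A) s \<and>
     (\<forall>a b c. p (p a b) c = p a (p b c + s b c)) \<and>
     (\<forall>a b c. p (s a b) c = s a (p b c)) \<and>
     (\<forall>a b c. s (p a b + s a b) c = s a (s b c)))"

definition dend_pi :: "('k, 'a::zero) dend_alg \<Rightarrow> nat \<Rightarrow> 'a list \<Rightarrow> 'a" where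
  "dend_pi A r xs =
     (if length xs \<noteq> 2 then 0
      else if r = 1 then dprec A (xs ! 0) (xs ! 1)
      else if r = 2 then dsucc A (xs ! 0) (xs ! 1)
      else 0)"

text \<open>The space \<open>M\<close> is the type \<open>'m\<close> with scalar multiplication \<open>t\<close>. The actions of the algebra on
  the left of \<open>M\<close> are \<open>lp = \<theta>\<^sub>1 [1]\<close>, \<open>ls = \<theta>\<^sub>1 [2]\<close>, those on the right are \<open>rp = \<theta>\<^sub>2 [1]\<close>,
  \<open>rs = \<theta>\<^sub>2 [2]\<close>. The nine identities are grouped by the position of the element of \<open>M\<close>.\<close>

definition dend_rep ::
  "('k::field_char_0, 'a::ab_group_add) dend_alg \<Rightarrow> ('k \<Rightarrow> 'm \<Rightarrow> 'm::ab_group_add) \<Rightarrow>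
   (nat \<Rightarrow> 'a \<Rightarrow> 'm \<Rightarrow> 'm) \<Rightarrow> (nat \<Rightarrow> 'm \<Rightarrow> 'a \<Rightarrow> 'm) \<Rightarrow> bool" where
  "dend_rep A t \<theta>1 \<theta>2 \<longleftrightarrow>
    (let p = dprec A; s = dsucc A; lp = \<theta>1 1; ls = \<theta>1 2; rp = \<theta>2 1; rs = \<theta>2 2 in
     vector_space t \<and>
     bilin (dscale A) t t lp \<and> bilin (dscale A) t t ls \<and>
     bilin t (dscale A) t rp \<and> bilin t (dscale A) t rs \<and>
     (\<forall>r. r \<notin> {1..2} \<longrightarrow> \<theta>1 r = (\<lambda>_ _. 0) \<and> \<theta>2 r = (\<lambda>_ _. 0)) \<and>
     (\<forall>a b m. lp (p a b) m = lp a (lp b m + ls b m)) \<and>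
     (\<forall>a b m. lp (s a b) m = ls a (lp b m)) \<and>
     (\<forall>a b m. ls (p a b + s a b) m = ls a (ls b m)) \<and>
     (\<forall>a m c. rp (lp a m) c = lp a (rp m c + rs m c)) \<and>
     (\<forall>a m c. rp (ls a m) c = ls a (rp m c)) \<and>
     (\<forall>a m c. rs (lp a m + ls a m) c = ls a (rs m c)) \<and>
     (\<forall>m b c. rp (rp m b) c = rp m (p b c + s b c)) \<and>
     (\<forall>m b c. rp (rs m b) c = rs m (p b c)) \<and>
     (\<forall>m b c. rs (rp m b + rs m b) c = rs m (s b c)))"

text \<open>The \<open>i\<close>-th summand of the middle sum is, up to sign, the partial composition \<open>f \<circ>\<^sub>i \<pi>\<close>.\<close>

definition dend_delta ::
  "('k::field_char_0, 'a::ab_group_add) dend_alg \<Rightarrow> ('k \<Rightarrow> 'm \<Rightarrow> 'm::ab_group_add) \<Rightarrow>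
   (nat \<Rightarrow> 'a \<Rightarrow> 'm \<Rightarrow> 'm) \<Rightarrow> (nat \<Rightarrow> 'm \<Rightarrow> 'a \<Rightarrow> 'm) \<Rightarrow> nat \<Rightarrow>
   (nat \<Rightarrow> 'a list \<Rightarrow> 'm) \<Rightarrow> nat \<Rightarrow> 'a list \<Rightarrow> 'm" where
  "dend_delta A t \<theta>1 \<theta>2 n f r xs =
     \<theta>1 (R0 2 n 2 r) (hd xs) (lin_ext t n f (R 2 n 2 r) (tl xs))
     + (\<Sum>i = 1..n. t ((-1) ^ i) (pcomp (dscale A) n 2 i f (dend_pi A) r xs))
     + t ((-1) ^ (n + 1)) (\<theta>2 (R0 2 n 1 r) (lin_ext t n f (R 2 n 1 r) (butlast xs)) (last xs))"

definition dend_cocycle ::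
  "('k::field_char_0, 'a::ab_group_add) dend_alg \<Rightarrow> ('k \<Rightarrow> 'm \<Rightarrow> 'm::ab_group_add) \<Rightarrow>
   (nat \<Rightarrow> 'a \<Rightarrow> 'm \<Rightarrow> 'm) \<Rightarrow> (nat \<Rightarrow> 'm \<Rightarrow> 'a \<Rightarrow> 'm) \<Rightarrow> nat \<Rightarrow>
   (nat \<Rightarrow> 'a list \<Rightarrow> 'm) \<Rightarrow> bool" where
  "dend_cocycle A t \<theta>1 \<theta>2 n f \<longleftrightarrow>
     f \<in> Hom_lab (dscale A) t n \<and>
     (\<forall>r \<in> {1..n + 1}. \<forall>xs. length xs = n + 1 \<longrightarrow> dend_delta A t \<theta>1 \<theta>2 n f r xs = 0)"

text \<open>A skeletal algebra is sent to its space \<open>A\<^sub>0\<close> with the products \<open>\<mu>\<^sub>2\<close> on \<open>A\<^sub>0 \<otimes> A\<^sub>0\<close>, the space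
  \<open>A\<^sub>1\<close> with the actions \<open>\<mu>\<^sub>2\<close> on \<open>A\<^sub>0 \<otimes> A\<^sub>1\<close> and \<open>A\<^sub>1 \<otimes> A\<^sub>0\<close>, and \<open>\<sigma> = \<mu>\<^sub>3\<close>.\<close>

definition skeletal_to_tuple ::
  "('k::field_char_0, 'a::ab_group_add, 'm::ab_group_add) dend_inf \<Rightarrow>
   ('k, 'a) dend_alg \<times> ('k \<Rightarrow> 'm \<Rightarrow> 'm) \<times> (nat \<Rightarrow> 'a \<Rightarrow> 'm \<Rightarrow> 'm) \<times>
   (nat \<Rightarrow> 'm \<Rightarrow> 'a \<Rightarrow> 'm) \<times> (nat \<Rightarrow> 'a list \<Rightarrow> 'm)" where
  "skeletal_to_tuple X =
     (\<lparr>dscale = scale0 X,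
       dprec = (\<lambda>a b. fst (mu2 X 1 [(a, 0), (b, 0)])),
       dsucc = (\<lambda>a b. fst (mu2 X 2 [(a, 0), (b, 0)]))\<rparr>,
      scale1 X,
      (\<lambda>r a m. snd (mu2 X r [(a, 0), (0, m)])),
      (\<lambda>r m a. snd (mu2 X r [(0, m), (a, 0)])),
      (\<lambda>r xs. snd (mu3 X r (map (\<lambda>a. (a, 0)) xs))))"

end

theory Submission
  imports Defs
begin

text \<open>
  Homogeneity of degree \<open>0\<close> and multilinearity force \<open>\<mu>\<^sub>2\<close> on \<open>A\<^sub>0 \<oplus> A\<^sub>1\<close> to consist of three
  bilinear components, on \<open>A\<^sub>0 \<otimes> A\<^sub>0\<close>, \<open>A\<^sub>0 \<otimes> A\<^sub>1\<close> and \<open>A\<^sub>1 \<otimes> A\<^sub>0\<close> (the one on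
  \<open>A\<^sub>1 \<otimes> A\<^sub>1\<close> is zero), and \<open>\<mu>\<^sub>3\<close>, of degree \<open>1\<close>, to be determined by a trilinear map
  \<open>A\<^sub>0 \<otimes> A\<^sub>0 \<otimes> A\<^sub>0 \<rightarrow> A\<^sub>1\<close>. Hence a skeletal algebra is recovered by gluing its
  components (\<open>skeletal_decomposition\<close>), and conversely any multilinear components can be glued to
  homogeneous maps \<open>\<mu>\<^sub>2\<close> and \<open>\<mu>\<^sub>3\<close>. It remains to compare the axioms on the two sides
  (\<open>two_term_glue_iff\<close>).

  As \<open>d = 0\<close>, the compatibility of \<open>\<mu>\<^sub>2\<close> with \<open>d\<close> is automatic, and \<open>\<mu>\<^sub>3\<close> no longer contributes
  to the identities saying that \<open>\<mu>\<^sub>2\<close> is associative up to homotopy: these become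
  \<open>\<mu>\<^sub>2 \<circ>\<^sub>1 \<mu>\<^sub>2 = \<mu>\<^sub>2 \<circ>\<^sub>2 \<mu>\<^sub>2\<close>. For the labels \<open>[1]\<close>, \<open>[2]\<close>, \<open>[3]\<close> these are the three dendriform
  identities: with all inputs in \<open>A\<^sub>0\<close> they are the axioms of a dendriform algebra, and with one
  input in \<open>A\<^sub>1\<close> those of a representation (\<open>associativity_iff\<close>). Finally, for inputs in \<open>A\<^sub>0\<close>, the
  difference of the two sides of the coherence identity between \<open>\<mu>\<^sub>2\<close> and \<open>\<mu>\<^sub>3\<close> is \<open>\<delta>\<sigma>\<close>: the terms
  \<open>\<mu>\<^sub>3 \<circ>\<^sub>i \<mu>\<^sub>2\<close> are, up to sign, the summands \<open>\<sigma> \<circ>\<^sub>i \<pi>\<close>, and \<open>\<mu>\<^sub>2 \<circ>\<^sub>2 \<mu>\<^sub>3\<close>, \<open>\<mu>\<^sub>2 \<circ>\<^sub>1 \<mu>\<^sub>3\<close> are the two outer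
  terms, given by the left and the right action (\<open>cocycle_identity\<close>).
\<close>

section \<open>Linear maps and the summands of the graded space\<close>

lemma vector_space_scale_tot:
  assumes "vector_space (scale0 X)" "vector_space (scale1 X)"
  shows "vector_space (scale_tot X)"
  using assms unfolding vector_space_def scale_tot_def by simp

text \<open>The inclusions of \<open>A\<^sub>0\<close> and \<open>A\<^sub>1\<close> into \<open>A\<^sub>0 \<oplus> A\<^sub>1\<close>.\<close>

definition incl0 :: "'a \<Rightarrow> 'a \<times> 'm::zero" where
  "incl0 a = (a, 0)"

definition incl1 :: "'m \<Rightarrow> 'a::zero \<times> 'm" where
  "incl1 m = (0, m)"

lemma incl_simps [simp]:
  "fst (incl0 a) = a" "snd (incl0 a) = 0" "fst (incl1 m) = 0" "snd (incl1 m) = m"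
  by (simp_all add: incl0_def incl1_def)

lemma ball_graded_part:
  "(\<forall>x\<in>graded_part 0. P x) \<longleftrightarrow> (\<forall>a. P (incl0 a))"
  "(\<forall>x\<in>graded_part 1. P x) \<longleftrightarrow> (\<forall>m. P (incl1 m))"
  by (auto simp: graded_part_def incl0_def incl1_def)

lemma incl_in_graded_part: "incl0 a \<in> graded_part 0" "incl1 m \<in> graded_part 1"
  by (auto simp: graded_part_def incl0_def incl1_def)

lemma linear_incl_proj:
  assumes "vector_space (scale0 X)" "vector_space (scale1 X)"
  shows "Vector_Spaces.linear (scale0 X) (scale_tot X) incl0"
    "Vector_Spaces.linear (scale1 X) (scale_tot X) incl1"
    "Vector_Spaces.linear (scale_tot X) (scale0 X) fst"
    "Vector_Spaces.linear (scale_tot X) (scale1 X) snd"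
  using assms vector_space_scale_tot[OF assms]
  by (auto simp: Vector_Spaces.linear_iff incl0_def incl1_def scale_tot_def
      module.scale_zero_right module_iff_vector_space)

lemma linear_comp:
  assumes "Vector_Spaces.linear s t f" "Vector_Spaces.linear t u g"
  shows "Vector_Spaces.linear s u (\<lambda>x. g (f x))"
  using assms by (simp add: Vector_Spaces.linear_iff)

lemmas linear_map_zero = module_hom.zero[OF module_hom_linearI]
  and linear_map_add = module_hom.add[OF module_hom_linearI]
  and linear_map_scale = module_hom.scale[OF module_hom_linearI]

lemma multilinear_slots2:
  "multilinear s t 2 f \<longleftrightarrow>
     (\<forall>y. Vector_Spaces.linear s t (\<lambda>x. f [x, y])) \<and> (\<forall>x. Vector_Spaces.linear s t (\<lambda>y. f [x, y]))"
  (is "?L = ?R")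
proof
  assume L: ?L
  have "Vector_Spaces.linear s t (\<lambda>x. f [x, y])" for y
    using L[unfolded multilinear_def, rule_format, of "[0, y]" 0] by simp
  moreover have "Vector_Spaces.linear s t (\<lambda>y. f [x, y])" for x
    using L[unfolded multilinear_def, rule_format, of "[x, 0]" 1] by simp
  ultimately show ?R by blast
next
  assume ?R
  then show ?L
    by (auto simp: multilinear_def length_Suc_conv less_Suc_eq numeral_2_eq_2)
qed

lemma multilinear_slots3:
  assumes "multilinear s t 3 f"
  shows "Vector_Spaces.linear s t (\<lambda>x. f [x, y, z])"
    "Vector_Spaces.linear s t (\<lambda>x. f [y, x, z])"
    "Vector_Spaces.linear s t (\<lambda>x. f [y, z, x])"
  using assms[unfolded multilinear_def, rule_format, of "[0, y, z]" 0]
    assms[unfolded multilinear_def, rule_format, of "[y, 0, z]" 1]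
    assms[unfolded multilinear_def, rule_format, of "[y, z, 0]" 2]
  by simp_all

lemma multilinear_transport:
  assumes "multilinear s t n f" "Vector_Spaces.linear s' s \<phi>" "Vector_Spaces.linear t t' \<psi>"
  shows "multilinear s' t' n (\<lambda>xs. \<psi> (f (map \<phi> xs)))"
  using assms unfolding multilinear_def
  by (auto simp: map_update intro!: linear_comp[OF _ assms(3)]
      linear_comp[OF assms(2), of _ "\<lambda>x. f (_[_ := x])"])

section \<open>Partial compositions\<close>

lemma lin_ext_transport:
  assumes "\<And>r. g r (map \<phi> xs) = \<psi> (g' r xs)"
    and "Vector_Spaces.linear s' s \<psi>"
  shows "lin_ext s n g u (map \<phi> xs) = \<psi> (lin_ext s' n g' u xs)"
proof -
  interpret Vector_Spaces.linear s' s \<psi> by (rule assms(2))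
  show ?thesis by (simp add: lin_ext_def assms(1) sum scale)
qed

text \<open>Partial composition is compatible with a linear map \<open>\<phi>\<close> of the inputs and a map \<open>\<psi>\<close> of the
  outputs; \<open>\<psi>\<close> need not be linear, since \<open>f\<close> is not extended in its label.\<close>

lemma pcomp_transport:
  assumes f: "\<And>r xs. f r (map \<phi> xs) = \<psi> (f' r xs)"
    and g: "\<And>r xs. length xs = n \<Longrightarrow> g r (map \<phi> xs) = \<phi> (g' r xs)"
    and \<phi>: "Vector_Spaces.linear s' s \<phi>"
    and len: "i - 1 + n \<le> length xs"
  shows "pcomp s m n i f g r (map \<phi> xs) = \<psi> (pcomp s' m n i f' g' r xs)"
proof -
  have "lin_ext s n g (R m n i r) (map \<phi> (take n (drop (i - 1) xs)))
      = \<phi> (lin_ext s' n g' (R m n i r) (take n (drop (i - 1) xs)))"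
    using len by (intro lin_ext_transport g \<phi>) simp
  then show ?thesis
    by (simp add: pcomp_def take_map drop_map flip: f)
qed

text \<open>For equal \<open>f\<close> and \<open>g\<close>, equating the two compositions with the same label gives the three
  dendriform identities.\<close>

lemma pcomp_binary:
  assumes "vector_space s"
  shows "pcomp s 2 2 1 f g 1 [x, y, z] = f 1 [g 1 [x, y], z]"
    "pcomp s 2 2 1 f g 2 [x, y, z] = f 1 [g 2 [x, y], z]"
    "pcomp s 2 2 1 f g 3 [x, y, z] = f 2 [g 1 [x, y] + g 2 [x, y], z]"
    "pcomp s 2 2 2 f g 1 [x, y, z] = f 1 [x, g 1 [y, z] + g 2 [y, z]]"
    "pcomp s 2 2 2 f g 2 [x, y, z] = f 2 [x, g 1 [y, z]]"
    "pcomp s 2 2 2 f g 3 [x, y, z] = f 2 [x, g 2 [y, z]]"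
proof -
  interpret vector_space s by (rule assms)
  show "pcomp s 2 2 1 f g 1 [x, y, z] = f 1 [g 1 [x, y], z]"
    "pcomp s 2 2 1 f g 2 [x, y, z] = f 1 [g 2 [x, y], z]"
    "pcomp s 2 2 1 f g 3 [x, y, z] = f 2 [g 1 [x, y] + g 2 [x, y], z]"
    "pcomp s 2 2 2 f g 1 [x, y, z] = f 1 [x, g 1 [y, z] + g 2 [y, z]]"
    "pcomp s 2 2 2 f g 2 [x, y, z] = f 2 [x, g 1 [y, z]]"
    "pcomp s 2 2 2 f g 3 [x, y, z] = f 2 [x, g 2 [y, z]]"
    by (simp_all add: pcomp_def lin_ext_def R0_def R_def numeral_2_eq_2 numeral_3_eq_3
        lookup_add lookup_single)
qed


section \<open>Graded data and the algebra glued from them\<close>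

text \<open>The multilinear maps underlying a tuple \<open>(A, M, \<theta>\<^sub>1, \<theta>\<^sub>2, \<sigma>)\<close>, with no identities imposed.
  The products of \<open>A\<close> are accessed through \<open>dend_pi A\<close>, which is zero for labels other than \<open>[1]\<close>
  and \<open>[2]\<close>, so that bilinearity can be asked for every label.\<close>

locale dend_data =
  fixes A :: "('k::field_char_0, 'a::ab_group_add) dend_alg"
    and t :: "'k \<Rightarrow> 'm \<Rightarrow> 'm::ab_group_add"
    and \<theta>1 :: "nat \<Rightarrow> 'a \<Rightarrow> 'm \<Rightarrow> 'm"
    and \<theta>2 :: "nat \<Rightarrow> 'm \<Rightarrow> 'a \<Rightarrow> 'm"
    and \<sigma> :: "nat \<Rightarrow> 'a list \<Rightarrow> 'm"
  assumes bilin_pi: "\<And>r. bilin (dscale A) (dscale A) (dscale A) (\<lambda>a b. dend_pi A r [a, b])"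
    and bilin_left: "\<And>r. bilin (dscale A) t t (\<theta>1 r)"
    and bilin_right: "\<And>r. bilin t (dscale A) t (\<theta>2 r)"
    and action_support: "\<And>r. r \<notin> {1..2} \<Longrightarrow> \<theta>1 r = (\<lambda>_ _. 0) \<and> \<theta>2 r = (\<lambda>_ _. 0)"
    and sigma: "\<sigma> \<in> Hom_lab (dscale A) t 3"

text \<open>The graded space \<open>A \<oplus> M\<close> with \<open>d = 0\<close>, whose \<open>\<mu>\<^sub>2\<close> is
  \<open>\<mu>\<^sub>2([r]; a + m, b + n) = \<pi>\<^sub>A([r]; a, b) + \<theta>\<^sub>1([r]; a, n) + \<theta>\<^sub>2([r]; m, b)\<close> and whose \<open>\<mu>\<^sub>3\<close> is
  \<open>\<sigma>\<close> applied to the components in \<open>A\<close>. No length test is needed for \<open>\<mu>\<^sub>3\<close>, because a cochain vanishes on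
  lists of other lengths.\<close>

definition glue ::
  "('k::field_char_0, 'a::ab_group_add) dend_alg \<Rightarrow> ('k \<Rightarrow> 'm \<Rightarrow> 'm::ab_group_add) \<Rightarrow>
   (nat \<Rightarrow> 'a \<Rightarrow> 'm \<Rightarrow> 'm) \<Rightarrow> (nat \<Rightarrow> 'm \<Rightarrow> 'a \<Rightarrow> 'm) \<Rightarrow> (nat \<Rightarrow> 'a list \<Rightarrow> 'm) \<Rightarrow>
   ('k, 'a, 'm) dend_inf" where
  "glue A t \<theta>1 \<theta>2 \<sigma> =
     \<lparr>scale0 = dscale A, scale1 = t, diff = (\<lambda>_. 0),
      mu2 = (\<lambda>r xs. if length xs = 2
        then (dend_pi A r (map fst xs),
              \<theta>1 r (fst (xs ! 0)) (snd (xs ! 1)) + \<theta>2 r (snd (xs ! 0)) (fst (xs ! 1)))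
        else 0),
      mu3 = (\<lambda>r xs. incl1 (\<sigma> r (map fst xs)))\<rparr>"

lemma glue_sel [simp]:
  "scale0 (glue A t \<theta>1 \<theta>2 \<sigma>) = dscale A"
  "scale1 (glue A t \<theta>1 \<theta>2 \<sigma>) = t"
  "diff (glue A t \<theta>1 \<theta>2 \<sigma>) = (\<lambda>_. 0)"
  "mu2 (glue A t \<theta>1 \<theta>2 \<sigma>) r [x, y] =
     (dend_pi A r [fst x, fst y], \<theta>1 r (fst x) (snd y) + \<theta>2 r (snd x) (fst y))"
  "length xs \<noteq> 2 \<Longrightarrow> mu2 (glue A t \<theta>1 \<theta>2 \<sigma>) r xs = 0"
  "mu3 (glue A t \<theta>1 \<theta>2 \<sigma>) r xs = incl1 (\<sigma> r (map fst xs))"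
  by (simp_all add: glue_def)

context dend_data
begin

abbreviation "X \<equiv> glue A t \<theta>1 \<theta>2 \<sigma>"

lemma vector_spaces: "vector_space (dscale A)" "vector_space t"
  using bilin_left by (auto simp: bilin_def Vector_Spaces.linear_iff)

lemma vector_space_total: "vector_space (scale_tot X)"
  by (rule vector_space_scale_tot) (simp_all add: vector_spaces)

lemmas linear_total = linear_incl_proj[of X, simplified, OF vector_spaces]

lemma linear_slots:
  "Vector_Spaces.linear (dscale A) (dscale A) (\<lambda>b. dend_pi A r [a, b])"
  "Vector_Spaces.linear (dscale A) (dscale A) (\<lambda>a. dend_pi A r [a, b])"
  "Vector_Spaces.linear t t (\<lambda>m. \<theta>1 r a m)"
  "Vector_Spaces.linear (dscale A) t (\<lambda>a. \<theta>1 r a m)"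
  "Vector_Spaces.linear (dscale A) t (\<lambda>a. \<theta>2 r m a)"
  "Vector_Spaces.linear t t (\<lambda>m. \<theta>2 r m a)"
  using bilin_pi bilin_left bilin_right by (auto simp: bilin_def)

lemmas slot_zero [simp] = linear_slots[THEN linear_map_zero]
lemmas slot_add = linear_slots[THEN linear_map_add]
lemmas slot_scale = linear_slots[THEN linear_map_scale]

lemma Hom_lab_mu2: "mu2 X \<in> Hom_lab (scale_tot X) (scale_tot X) 2"
proof -
  have lin: "Vector_Spaces.linear (scale_tot X) (scale_tot X) (\<lambda>x. mu2 X r [x, y])"
    "Vector_Spaces.linear (scale_tot X) (scale_tot X) (\<lambda>x. mu2 X r [y, x])" for r y
    by (auto simp: Vector_Spaces.linear_iff vector_space_total slot_add slot_scale scale_tot_def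
        module.scale_right_distrib module_iff_vector_space vector_spaces)
  have "mu2 X r xs = 0" if "r \<notin> {1..2}" for r xs
  proof (cases "length xs = 2")
    case True
    then obtain x y where "xs = [x, y]"
      by (auto simp: length_Suc_conv numeral_2_eq_2)
    then show ?thesis
      using that action_support[OF that] by (auto simp: dend_pi_def zero_prod_def)
  qed simp
  then show ?thesis
    using lin by (auto simp: Hom_lab_def multilinear_slots2)
qed

lemma Hom_lab_mu3: "mu3 X \<in> Hom_lab (scale_tot X) (scale_tot X) 3"
proof -
  have "multilinear (scale_tot X) (scale_tot X) 3 (mu3 X r)" if "r \<in> {1..3}" for r
    using multilinear_transport[OF _ linear_total(3,2), of 3 "\<sigma> r"] sigma that
    by (simp add: Hom_lab_def glue_sel(6)[abs_def])
  then show ?thesis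
    using sigma by (auto simp: Hom_lab_def incl1_def zero_prod_def)
qed

lemma sigma_zero: "0 \<in> set xs \<Longrightarrow> \<sigma> r xs = 0"
proof -
  assume "0 \<in> set xs"
  then obtain i where i: "i < length xs" "xs ! i = 0"
    by (auto simp: in_set_conv_nth)
  show ?thesis
  proof (cases "r \<in> {1..3} \<and> length xs = 3")
    case True
    then have "Vector_Spaces.linear (dscale A) t (\<lambda>x. \<sigma> r (xs[i := x]))"
      using sigma i by (auto simp: Hom_lab_def multilinear_def)
    from linear_map_zero[OF this] show ?thesis
      using i by (metis list_update_id)
  qed (use sigma in \<open>auto simp: Hom_lab_def\<close>)
qed

lemma homogeneous_mu2: "homogeneous 0 (mu2 X)"
  unfolding homogeneous_def
proof (intro allI impI)
  fix r ks and xs :: "('a \<times> 'm) list"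
  assume *: "list_all2 (\<lambda>k x. x \<in> graded_part k) ks xs"
  show "mu2 X r xs \<in> graded_part (sum_list ks + 0)"
  proof (cases "length xs = 2")
    case True
    then obtain x y where "xs = [x, y]"
      by (auto simp: length_Suc_conv numeral_2_eq_2)
    with * show ?thesis
      by (auto simp: list_all2_Cons2 graded_part_def)
  qed (simp add: graded_part_def zero_prod_def)
qed

lemma homogeneous_mu3: "homogeneous 1 (mu3 X)"
  unfolding homogeneous_def
proof (intro allI impI)
  fix r ks and xs :: "('a \<times> 'm) list"
  assume *: "list_all2 (\<lambda>k x. x \<in> graded_part k) ks xs"
  show "mu3 X r xs \<in> graded_part (sum_list ks + 1)"
  proof (cases "sum_list ks = 0")
    case True
    then show ?thesis by (auto simp: incl1_def graded_part_def)
  next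
    case False
    then obtain i where i: "i < length ks" "ks ! i \<noteq> 0"
      by (auto simp: in_set_conv_nth)
    then have "i < length xs" "fst (xs ! i) = 0"
      using * by (auto simp: list_all2_conv_all_nth graded_part_def)
    then have "0 \<in> set (map fst xs)"
      by (metis in_set_conv_nth length_map nth_map)
    then show ?thesis
      by (auto simp: sigma_zero incl1_def graded_part_def)
  qed
qed

text \<open>The four families of inputs give, in this order, the axioms of a dendriform algebra and those
  of a representation with the element of \<open>M\<close> in the third, second and first place.\<close>

lemma associativity_iff:
  "(\<forall>r\<in>{1..3}. \<forall>a b c. pcomp (scale_tot X) 2 2 1 (mu2 X) (mu2 X) r [incl0 a, incl0 b, incl0 c]
        - pcomp (scale_tot X) 2 2 2 (mu2 X) (mu2 X) r [incl0 a, incl0 b, incl0 c] = 0) \<and>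
   (\<forall>r\<in>{1..3}. \<forall>a b m. pcomp (scale_tot X) 2 2 1 (mu2 X) (mu2 X) r [incl0 a, incl0 b, incl1 m]
        - pcomp (scale_tot X) 2 2 2 (mu2 X) (mu2 X) r [incl0 a, incl0 b, incl1 m] = 0) \<and>
   (\<forall>r\<in>{1..3}. \<forall>a m c. pcomp (scale_tot X) 2 2 1 (mu2 X) (mu2 X) r [incl0 a, incl1 m, incl0 c]
        - pcomp (scale_tot X) 2 2 2 (mu2 X) (mu2 X) r [incl0 a, incl1 m, incl0 c] = 0) \<and>
   (\<forall>r\<in>{1..3}. \<forall>m b c. pcomp (scale_tot X) 2 2 1 (mu2 X) (mu2 X) r [incl1 m, incl0 b, incl0 c]
        - pcomp (scale_tot X) 2 2 2 (mu2 X) (mu2 X) r [incl1 m, incl0 b, incl0 c] = 0)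
   \<longleftrightarrow> dendriform A \<and> dend_rep A t \<theta>1 \<theta>2"
proof -
  have labels: "{1..3} = {1, 2, 3::nat}"
    by auto
  have "\<theta>1 r = (\<lambda>_ _. 0) \<and> \<theta>2 r = (\<lambda>_ _. 0)" if "r \<notin> {1..2}" for r
    using action_support[OF that] .
  moreover have "bilin (dscale A) (dscale A) (dscale A) (dprec A)"
    "bilin (dscale A) (dscale A) (dscale A) (dsucc A)"
    using bilin_pi[of 1] bilin_pi[of 2] by (simp_all add: dend_pi_def)
  ultimately show ?thesis
    unfolding labels ball_simps pcomp_binary[OF vector_space_total] dendriform_def dend_rep_def Let_def
    using bilin_left bilin_right vector_spaces
    by (auto simp add: dend_pi_def zero_prod_def)
qed

text \<open>The failure of the coherence identity between \<open>\<mu>\<^sub>2\<close> and \<open>\<mu>\<^sub>3\<close> is the coboundary of \<open>\<sigma>\<close>.\<close>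

lemma cocycle_identity:
  assumes "length as = 4"
  defines "xs \<equiv> map incl0 as"
  shows "pcomp (scale_tot X) 2 3 1 (mu2 X) (mu3 X) r xs + pcomp (scale_tot X) 2 3 2 (mu2 X) (mu3 X) r xs
      - (pcomp (scale_tot X) 3 2 1 (mu3 X) (mu2 X) r xs - pcomp (scale_tot X) 3 2 2 (mu3 X) (mu2 X) r xs
         + pcomp (scale_tot X) 3 2 3 (mu3 X) (mu2 X) r xs)
      = incl1 (dend_delta A t \<theta>1 \<theta>2 3 \<sigma> r as)"
proof -
  obtain a b c e where as: "as = [a, b, c, e]"
    using assms(1) by (auto simp: length_Suc_conv numeral_eq_Suc)
  interpret M: vector_space t by (rule vector_spaces)
  have minus: "t (- 1) m = - m" for m
    using M.scale_minus_left[of 1 m] by simp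
  have proj: "map fst (map incl0 ys) = ys" for ys :: "'a list"
    by (simp add: comp_def)
  have mu2_incl0: "mu2 X r (map incl0 ys) = incl0 (dend_pi A r ys)"
    if "length ys = 2" for r ys
    using that by (auto simp: length_Suc_conv numeral_2_eq_2 incl0_def)
  have sigma_comp: "pcomp (scale_tot X) 3 2 i (mu3 X) (mu2 X) r xs
      = incl1 (pcomp (dscale A) 3 2 i \<sigma> (dend_pi A) r as)" if "i \<in> {1, 2, 3}" for i
    unfolding xs_def
    using that as by (intro pcomp_transport linear_total(1) mu2_incl0) (auto simp: comp_def)
  have lin_ext: "lin_ext (scale_tot X) 3 (mu3 X) u (map incl0 ys) = incl1 (lin_ext t 3 \<sigma> u ys)"
    for u and ys :: "'a list"
    by (rule lin_ext_transport[OF _ linear_total(2)]) (simp add: comp_def)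
  have right: "pcomp (scale_tot X) 2 3 1 (mu2 X) (mu3 X) r xs
      = incl1 (\<theta>2 (R0 2 3 1 r) (lin_ext t 3 \<sigma> (R 2 3 1 r) [a, b, c]) e)"
    using lin_ext[of "R 2 3 1 r" "[a, b, c]"]
    by (simp add: pcomp_def xs_def as numeral_3_eq_3 incl1_def)
  have left: "pcomp (scale_tot X) 2 3 2 (mu2 X) (mu3 X) r xs
      = incl1 (\<theta>1 (R0 2 3 2 r) a (lin_ext t 3 \<sigma> (R 2 3 2 r) [b, c, e]))"
    using lin_ext[of "R 2 3 2 r" "[b, c, e]"]
    by (simp add: pcomp_def xs_def as numeral_3_eq_3 incl1_def)
  have sum3: "(\<Sum>i = 1..3. f i) = f 1 + f 2 + f 3" for f :: "nat \<Rightarrow> 'm"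
    by (simp add: numeral_3_eq_3 numeral_2_eq_2)
  show ?thesis
    unfolding left right dend_delta_def sum3
    by (simp add: sigma_comp[simplified] minus as) (simp add: incl1_def)
qed

lemma coherence_iff_cocycle:
  "(\<forall>r\<in>{1..4}. \<forall>a b c e.
      pcomp (scale_tot X) 3 2 1 (mu3 X) (mu2 X) r [incl0 a, incl0 b, incl0 c, incl0 e]
        - pcomp (scale_tot X) 3 2 2 (mu3 X) (mu2 X) r [incl0 a, incl0 b, incl0 c, incl0 e]
        + pcomp (scale_tot X) 3 2 3 (mu3 X) (mu2 X) r [incl0 a, incl0 b, incl0 c, incl0 e]
      = pcomp (scale_tot X) 2 3 1 (mu2 X) (mu3 X) r [incl0 a, incl0 b, incl0 c, incl0 e]
        + pcomp (scale_tot X) 2 3 2 (mu2 X) (mu3 X) r [incl0 a, incl0 b, incl0 c, incl0 e])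
   \<longleftrightarrow> dend_cocycle A t \<theta>1 \<theta>2 3 \<sigma>"
  (is "?L \<longleftrightarrow> _")
proof -
  have zero: "z - y = incl1 d \<Longrightarrow> y = z \<longleftrightarrow> d = 0" for y z :: "'a \<times> 'm" and d
    by (metis eq_iff_diff_eq_0 incl_simps(4) incl1_def zero_prod_def)
  have "?L \<longleftrightarrow> (\<forall>r\<in>{1..4}. \<forall>a b c e. dend_delta A t \<theta>1 \<theta>2 3 \<sigma> r [a, b, c, e] = 0)"
    by (intro ball_cong refl arg_cong[of _ _ All] ext)
      (rule zero, use cocycle_identity[of "[_, _, _, _]"] in simp)
  also have "\<dots> \<longleftrightarrow> (\<forall>r\<in>{1..4}. \<forall>xs. length xs = 4 \<longrightarrow> dend_delta A t \<theta>1 \<theta>2 3 \<sigma> r xs = 0)"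
    by (fastforce simp: length_Suc_conv numeral_eq_Suc)
  finally show ?thesis
    using sigma by (simp add: dend_cocycle_def)
qed

lemma two_term_glue_iff:
  "two_term_dend_inf X \<longleftrightarrow>
     dendriform A \<and> dend_rep A t \<theta>1 \<theta>2 \<and> dend_cocycle A t \<theta>1 \<theta>2 3 \<sigma>"
proof -
  have d: "diff_tot X = (\<lambda>_. 0)"
    by (simp add: diff_tot_def fun_eq_iff zero_prod_def)
  have lin: "Vector_Spaces.linear t (dscale A) (\<lambda>_. 0)"
    using vector_spaces
    by (simp add: Vector_Spaces.linear_iff module.scale_zero_right module_iff_vector_space)
  have mu2: "mu2 X r [incl1 m, incl1 n] = 0" "mu2 X r [x, 0] = 0" "mu2 X r [0, x] = 0" for r m n x
    by (simp_all add: zero_prod_def)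
  have mu3: "mu3 X r [x, y, 0] = 0" "mu3 X r [x, 0, y] = 0" "mu3 X r [0, x, y] = 0" for r x y
    by (simp_all add: sigma_zero incl1_def zero_prod_def)
  note facts = vector_spaces lin Hom_lab_mu2 Hom_lab_mu3 homogeneous_mu2 homogeneous_mu3
  show ?thesis
    unfolding two_term_dend_inf_def Let_def ball_graded_part d glue_sel(1-3) mu2 mu3
    unfolding coherence_iff_cocycle
    using facts associativity_iff by blast
qed

lemma skeletal_to_tuple_glue: "skeletal_to_tuple X = (A, t, \<theta>1, \<theta>2, \<sigma>)"
  by (simp add: skeletal_to_tuple_def dend_pi_def comp_def)

end

section \<open>A skeletal algebra is glued from its graded components\<close>

lemma skeletal_to_tuple_incl:
  "skeletal_to_tuple X =
     (\<lparr>dscale = scale0 X,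
       dprec = (\<lambda>a b. fst (mu2 X 1 [incl0 a, incl0 b])),
       dsucc = (\<lambda>a b. fst (mu2 X 2 [incl0 a, incl0 b]))\<rparr>,
      scale1 X,
      (\<lambda>r a m. snd (mu2 X r [incl0 a, incl1 m])),
      (\<lambda>r m a. snd (mu2 X r [incl1 m, incl0 a])),
      (\<lambda>r xs. snd (mu3 X r (map incl0 xs))))"
  by (simp add: skeletal_to_tuple_def incl0_def[abs_def] incl1_def)

lemma multilinear_Hom_lab:
  assumes "f \<in> Hom_lab s t n" "vector_space s" "vector_space t"
  shows "multilinear s t n (f r)"
proof (cases "r \<in> {1..n}")
  case False
  then have "f r = (\<lambda>_. 0)"
    using assms(1) by (auto simp: Hom_lab_def)
  then show ?thesis
    using assms(2,3)
    by (simp add: multilinear_def Vector_Spaces.linear_iff module.scale_zero_right module_iff_vector_space)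
qed (use assms(1) in \<open>simp add: Hom_lab_def\<close>)

text \<open>Multilinearity passes to the components of \<open>\<mu>\<^sub>2\<close> and \<open>\<mu>\<^sub>3\<close>. These determine \<open>X\<close>: in the
  multilinear expansion of \<open>\<mu>\<^sub>2\<close> and \<open>\<mu>\<^sub>3\<close>, each term lies in a single degree, and those of degree at
  least 2 are zero.\<close>

lemma skeletal_decomposition:
  fixes X :: "('k::field_char_0, 'a::ab_group_add, 'm::ab_group_add) dend_inf"
  assumes X: "two_term_dend_inf X" "skeletal X"
    and tuple: "skeletal_to_tuple X = (A, t, \<theta>1, \<theta>2, \<sigma>)"
  shows "dend_data A t \<theta>1 \<theta>2 \<sigma>" and "glue A t \<theta>1 \<theta>2 \<sigma> = X"
proof -
  let ?s = "scale_tot X"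
  have vs: "vector_space (scale0 X)" "vector_space (scale1 X)"
    and mu2: "mu2 X \<in> Hom_lab ?s ?s 2" "homogeneous 0 (mu2 X)"
    and mu3: "mu3 X \<in> Hom_lab ?s ?s 3" "homogeneous 1 (mu3 X)"
    and mu2_11: "\<And>r m n. r \<in> {1..2} \<Longrightarrow> mu2 X r [incl1 m, incl1 n] = 0"
    using X(1) unfolding two_term_dend_inf_def Let_def ball_graded_part by auto
  note vsT = vector_space_scale_tot[OF vs] and lin = linear_incl_proj[OF vs]
  have A: "A = \<lparr>dscale = scale0 X,
       dprec = (\<lambda>a b. fst (mu2 X 1 [incl0 a, incl0 b])),
       dsucc = (\<lambda>a b. fst (mu2 X 2 [incl0 a, incl0 b]))\<rparr>"
    and t: "t = scale1 X"
    and \<theta>1: "\<theta>1 = (\<lambda>r a m. snd (mu2 X r [incl0 a, incl1 m]))"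
    and \<theta>2: "\<theta>2 = (\<lambda>r m a. snd (mu2 X r [incl1 m, incl0 a]))"
    and \<sigma>: "\<sigma> = (\<lambda>r xs. snd (mu3 X r (map incl0 xs)))"
    using tuple unfolding skeletal_to_tuple_incl by simp_all
  have outside: "mu2 X r xs = 0" if "r \<notin> {1..2} \<or> length xs \<noteq> 2" for r xs
    using mu2(1) that by (auto simp: Hom_lab_def)
  have pi: "dend_pi A r [a, b] = fst (mu2 X r [incl0 a, incl0 b])" for r a b
    using outside[of r "[incl0 a, incl0 b]"] by (auto simp: dend_pi_def A)
  have slots: "Vector_Spaces.linear ?s ?s (\<lambda>x. mu2 X r [x, y])"
    "Vector_Spaces.linear ?s ?s (\<lambda>y. mu2 X r [x, y])" for r x y
    using multilinear_Hom_lab[OF mu2(1) vsT vsT] unfolding multilinear_slots2 by blast+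
  have comps: "Vector_Spaces.linear u w (\<lambda>x. p (mu2 X r [j x, y]))"
    "Vector_Spaces.linear u w (\<lambda>x. p (mu2 X r [y, j x]))"
    if "Vector_Spaces.linear u ?s j" "Vector_Spaces.linear ?s w p"
    for r y and u :: "'k \<Rightarrow> 'c \<Rightarrow> 'c::ab_group_add" and w :: "'k \<Rightarrow> 'd \<Rightarrow> 'd::ab_group_add" and j p
    using linear_comp[OF linear_comp[OF that(1) slots(1)] that(2)]
      linear_comp[OF linear_comp[OF that(1) slots(2)] that(2)] by blast+
  show data: "dend_data A t \<theta>1 \<theta>2 \<sigma>"
  proof
    have scale: "dscale A = scale0 X"
      by (simp add: A)
    fix r
    show "bilin (dscale A) (dscale A) (dscale A) (\<lambda>a b. dend_pi A r [a, b])"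
      "bilin (dscale A) t t (\<theta>1 r)" "bilin t (dscale A) t (\<theta>2 r)"
      unfolding pi \<theta>1 \<theta>2 t scale bilin_def by (intro conjI allI comps lin)+
    show "\<theta>1 r = (\<lambda>_ _. 0) \<and> \<theta>2 r = (\<lambda>_ _. 0)" if "r \<notin> {1..2}"
      using outside that by (simp add: \<theta>1 \<theta>2)
    show "\<sigma> \<in> Hom_lab (dscale A) t 3"
      unfolding \<sigma> t scale Hom_lab_def
    proof (intro CollectI conjI ballI allI impI)
      show "multilinear (scale0 X) (scale1 X) 3 (\<lambda>xs. snd (mu3 X q (map incl0 xs)))" for q
        by (rule multilinear_transport[OF multilinear_Hom_lab[OF mu3(1) vsT vsT] lin(1,4)])
      show "snd (mu3 X q (map incl0 xs)) = 0" if "q \<notin> {1..3} \<or> length xs \<noteq> 3" for q xs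
        using mu3(1) that by (auto simp: Hom_lab_def)
    qed
  qed
  have split: "x = incl0 (fst x) + incl1 (snd x)" for x :: "'a \<times> 'm"
    by (simp add: incl0_def incl1_def)
  have homog2: "mu2 X r [x, y] \<in> graded_part (i + j)"
    if "x \<in> graded_part i" "y \<in> graded_part j" for r x y i j
    using mu2(2)[unfolded homogeneous_def, rule_format, of "[i, j]" "[x, y]" r] that by simp
  have homog3: "mu3 X r [x, y, z] \<in> graded_part (i + j + k + 1)"
    if "x \<in> graded_part i" "y \<in> graded_part j" "z \<in> graded_part k" for r x y z i j k
    using mu3(2)[unfolded homogeneous_def, rule_format, of "[i, j, k]" "[x, y, z]" r] that
    by (simp add: add.assoc)
  have eq2: "mu2 X r [x, y] = mu2 (glue A t \<theta>1 \<theta>2 \<sigma>) r [x, y]" for r x y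
  proof -
    obtain a m b n where xy: "x = incl0 a + incl1 m" "y = incl0 b + incl1 n"
      using split by metis
    have "mu2 X r [x, y] = mu2 X r [incl0 a, incl0 b] + mu2 X r [incl0 a, incl1 n]
        + mu2 X r [incl1 m, incl0 b] + mu2 X r [incl1 m, incl1 n]"
      by (simp add: xy slots[THEN linear_map_add] add.assoc)
    moreover have "mu2 X r [incl1 m, incl1 n] = 0"
      using mu2_11 outside by metis
    moreover have "mu2 X r [incl0 a, incl0 b] = (dend_pi A r [a, b], 0)"
      using homog2[OF incl_in_graded_part(1) incl_in_graded_part(1), of r a b]
      by (auto simp: pi graded_part_def)
    moreover have "mu2 X r [incl0 a, incl1 n] = (0, \<theta>1 r a n)"
      using homog2[OF incl_in_graded_part(1) incl_in_graded_part(2), of r a n]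
      by (auto simp: \<theta>1 graded_part_def)
    moreover have "mu2 X r [incl1 m, incl0 b] = (0, \<theta>2 r m b)"
      using homog2[OF incl_in_graded_part(2) incl_in_graded_part(1), of r m b]
      by (auto simp: \<theta>2 graded_part_def)
    ultimately show ?thesis
      by (simp add: xy)
  qed
  have mu2_eq: "mu2 (glue A t \<theta>1 \<theta>2 \<sigma>) r xs = mu2 X r xs" for r xs
  proof (cases "length xs = 2")
    case True
    then obtain x y where "xs = [x, y]"
      by (auto simp: length_Suc_conv numeral_2_eq_2)
    then show ?thesis
      using eq2 by simp
  qed (simp add: outside)
  have slots3: "Vector_Spaces.linear ?s ?s (\<lambda>x. mu3 X r [x, y, z])"
    "Vector_Spaces.linear ?s ?s (\<lambda>x. mu3 X r [y, x, z])"
    "Vector_Spaces.linear ?s ?s (\<lambda>x. mu3 X r [y, z, x])" for r y z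
    using multilinear_slots3[OF multilinear_Hom_lab[OF mu3(1) vsT vsT]] by blast+
  have eq3: "mu3 X r [x, y, z] = incl1 (\<sigma> r [fst x, fst y, fst z])" for r x y z
  proof -
    obtain a m b n c p where xyz: "x = incl0 a + incl1 m" "y = incl0 b + incl1 n" "z = incl0 c + incl1 p"
      using split by metis
    \<comment> \<open>An input of degree 1 puts the value of \<open>\<mu>\<^sub>3\<close> in degree at least 2.\<close>
    have high: "graded_part (Suc (Suc k)) = {0 :: 'a \<times> 'm}" for k
      by (auto simp: graded_part_def zero_prod_def)
    have vanish: "mu3 X r [incl1 m, incl0 b, incl0 c] = 0" "mu3 X r [incl0 a, incl1 n, incl0 c] = 0"
      "mu3 X r [incl0 a, incl0 b, incl1 p] = 0" "mu3 X r [incl1 m, incl1 n, incl0 c] = 0"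
      "mu3 X r [incl1 m, incl0 b, incl1 p] = 0" "mu3 X r [incl0 a, incl1 n, incl1 p] = 0"
      "mu3 X r [incl1 m, incl1 n, incl1 p] = 0"
      using homog3[of _ 1 _ 0 _ 0] homog3[of _ 0 _ 1 _ 0] homog3[of _ 0 _ 0 _ 1]
        homog3[of _ 1 _ 1 _ 0] homog3[of _ 1 _ 0 _ 1] homog3[of _ 0 _ 1 _ 1] homog3[of _ 1 _ 1 _ 1]
      by (simp_all add: incl_in_graded_part[simplified] high numeral_eq_Suc)
    have "mu3 X r [x, y, z] = mu3 X r [incl0 a, incl0 b, incl0 c]"
      by (simp add: xyz slots3[THEN linear_map_add] vanish)
    also have "\<dots> = incl1 (\<sigma> r [a, b, c])"
      using homog3[OF incl_in_graded_part(1) incl_in_graded_part(1) incl_in_graded_part(1), of r a b c]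
      by (auto simp: \<sigma> graded_part_def incl1_def)
    finally show ?thesis
      by (simp add: xyz)
  qed
  have mu3_eq: "mu3 (glue A t \<theta>1 \<theta>2 \<sigma>) r xs = mu3 X r xs" for r xs
  proof (cases "length xs = 3")
    case True
    then obtain x y z where "xs = [x, y, z]"
      by (auto simp: length_Suc_conv numeral_3_eq_3)
    then show ?thesis
      using eq3 by simp
  next
    case False
    then show ?thesis
      using mu3(1) by (simp add: Hom_lab_def \<sigma> incl1_def zero_prod_def)
  qed
  have "scale0 (glue A t \<theta>1 \<theta>2 \<sigma>) = scale0 X" "scale1 (glue A t \<theta>1 \<theta>2 \<sigma>) = scale1 X"
    "diff (glue A t \<theta>1 \<theta>2 \<sigma>) = diff X"
    using X(2) by (simp_all add: A t skeletal_def)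
  moreover have "mu2 (glue A t \<theta>1 \<theta>2 \<sigma>) = mu2 X" "mu3 (glue A t \<theta>1 \<theta>2 \<sigma>) = mu3 X"
    using mu2_eq mu3_eq by (intro ext; simp)+
  ultimately show "glue A t \<theta>1 \<theta>2 \<sigma> = X"
    by (intro dend_inf.equality) simp_all
qed

lemma dend_data_of_tuple:
  assumes "dendriform A" "dend_rep A t \<theta>1 \<theta>2" "dend_cocycle A t \<theta>1 \<theta>2 3 \<sigma>"
  shows "dend_data A t \<theta>1 \<theta>2 \<sigma>"
proof
  have vs: "vector_space (dscale A)" "vector_space t"
    using assms(1,2) by (simp_all add: dendriform_def dend_rep_def Let_def)
  have outside: "\<theta>1 r = (\<lambda>_ _. 0) \<and> \<theta>2 r = (\<lambda>_ _. 0)" if "r \<notin> {1..2}" for r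
    using assms(2) that by (simp add: dend_rep_def Let_def)
  have zero: "bilin u v w (\<lambda>_ _. 0)"
    if "vector_space u" "vector_space v" "vector_space w"
    for u :: "'a \<Rightarrow> 'x \<Rightarrow> 'x::ab_group_add" and v :: "'a \<Rightarrow> 'y \<Rightarrow> 'y::ab_group_add"
      and w :: "'a \<Rightarrow> 'z \<Rightarrow> 'z::ab_group_add"
    using that
    by (simp add: bilin_def Vector_Spaces.linear_iff module.scale_zero_right module_iff_vector_space)
  fix r :: nat
  consider "r = 1" | "r = 2" | "r \<notin> {1..2}"
    by fastforce
  then show "bilin (dscale A) (dscale A) (dscale A) (\<lambda>a b. dend_pi A r [a, b])"
    "bilin (dscale A) t t (\<theta>1 r)" "bilin t (dscale A) t (\<theta>2 r)"
    using assms(1,2) outside[of r] zero vs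
    by (cases; auto simp: dend_pi_def dendriform_def dend_rep_def Let_def)+
  show "\<theta>1 r = (\<lambda>_ _. 0) \<and> \<theta>2 r = (\<lambda>_ _. 0)" if "r \<notin> {1..2}"
    using outside[OF that] .
  show "\<sigma> \<in> Hom_lab (dscale A) t 3"
    using assms(3) by (simp add: dend_cocycle_def)
qed

section \<open>The correspondence\<close>

theorem theorem6p2:
  shows "bij_betw skeletal_to_tuple
    {X :: ('k::field_char_0, 'a::ab_group_add, 'm::ab_group_add) dend_inf.
       two_term_dend_inf X \<and> skeletal X}
    {(A, t, \<theta>1, \<theta>2, \<sigma>). dendriform A \<and> dend_rep A t \<theta>1 \<theta>2 \<and> dend_cocycle A t \<theta>1 \<theta>2 3 \<sigma>}"
  (is "bij_betw _ ?S ?T")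
proof (rule bij_betw_byWitness[where f' = "\<lambda>(A, t, \<theta>1, \<theta>2, \<sigma>). glue A t \<theta>1 \<theta>2 \<sigma>"])
  show "\<forall>X\<in>?S. (\<lambda>(A, t, \<theta>1, \<theta>2, \<sigma>). glue A t \<theta>1 \<theta>2 \<sigma>) (skeletal_to_tuple X) = X"
    using skeletal_decomposition(2) by (auto split: prod.split)
  show "\<forall>T\<in>?T. skeletal_to_tuple ((\<lambda>(A, t, \<theta>1, \<theta>2, \<sigma>). glue A t \<theta>1 \<theta>2 \<sigma>) T) = T"
    using dend_data.skeletal_to_tuple_glue[OF dend_data_of_tuple] by auto
  show "skeletal_to_tuple ` ?S \<subseteq> ?T"
  proof clarify
    fix X :: "('k, 'a, 'm) dend_inf" and A t \<theta>1 \<theta>2 \<sigma>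
    assume X: "two_term_dend_inf X" "skeletal X" and tuple: "(A, t, \<theta>1, \<theta>2, \<sigma>) = skeletal_to_tuple X"
    show "dendriform A \<and> dend_rep A t \<theta>1 \<theta>2 \<and> dend_cocycle A t \<theta>1 \<theta>2 3 \<sigma>"
      using dend_data.two_term_glue_iff[OF skeletal_decomposition(1)[OF X tuple[symmetric]]]
        skeletal_decomposition(2)[OF X tuple[symmetric]] X(1) by simp
  qed
  show "(\<lambda>(A, t, \<theta>1, \<theta>2, \<sigma>). glue A t \<theta>1 \<theta>2 \<sigma>) ` ?T \<subseteq> ?S"
  proof clarify
    fix A :: "('k, 'a) dend_alg" and t :: "'k \<Rightarrow> 'm \<Rightarrow> 'm" and \<theta>1 \<theta>2 \<sigma>
    assume T: "dendriform A" "dend_rep A t \<theta>1 \<theta>2" "dend_cocycle A t \<theta>1 \<theta>2 3 \<sigma>"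
    then show "two_term_dend_inf (glue A t \<theta>1 \<theta>2 \<sigma>) \<and> skeletal (glue A t \<theta>1 \<theta>2 \<sigma>)"
      using dend_data.two_term_glue_iff[OF dend_data_of_tuple[OF T]] by (simp add: skeletal_def)
  qed
qed

end
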